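(* Let $1<p<\infty$ and $p'=\frac{p}{p-1}$, and let $n=m+k$. Then, for all non-zero complex-valued $f\in C_{0}^{\infty}(\mathbb{R}^{m+k}\setminus\{x=0\})$, $$\left(\int_{\mathbb{R}^{n}}\frac{\rho^{\gamma p}}{|x|^{\gamma p}}|\nabla_{\gamma}f|^{p}\,dz\right)\left(\int_{\mathbb{R}^{n}}\rho^{p'}|f|^{p}\,dz\right)^{p-1}=\left(\frac{Q}{p}\right)^{p}\left(\int_{\mathbb{R}^{n}}|f|^{p}\,dz\right)^{p}+\left(\int_{\mathbb{R}^{n}}\rho^{p'}|f|^{p}\,dz\right)^{p-1}\int_{\mathbb{R}^{n}}\frac{\rho^{\gamma p}}{|x|^{\gamma p}}\,C_{p}\left(\nabla_{\gamma}f,e^{-\alpha_{p,Q,\gamma}\rho^{p'}}\nabla_{\gamma}\left(\frac{f}{e^{-\alpha_{p,Q,\gamma}\rho^{p'}}}\right)\right)dz,$$ where $$\alpha_{p,Q,\gamma}=\frac{Q}{p}\,\frac{p-1}{p}\,\frac{\int_{\mathbb{R}^{n}}|f|^{p}\,dz}{\int_{\mathbb{R}^{n}}\rho^{p'}|f|^{p}\,dz}.$$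
   Context: Baouendi–Grushin setting: $m,k\ge 1$ are integers, $\gamma\geq0$ is a real number, points are $z=(x,y)\in\mathbb{R}^{m}\times\mathbb{R}^{k}=\mathbb{R}^{m+k}$, $|\cdot|$ is the Euclidean norm and $dz$ is Lebesgue measure. The gradient is $\nabla_{\gamma}=(\nabla_x,|x|^{\gamma}\nabla_y)$. The homogeneous dimension is $Q=m+(1+\gamma)k$, and $$\rho=\rho(z)=\left(|x|^{2(1+\gamma)}+(1+\gamma)^2|y|^2\right)^{\frac{1}{2(1+\gamma)}}.$$ $C_0^\infty(\Omega)$ is the space of smooth functions compactly supported in $\Omega$. For $1<p<\infty$ and $\xi,\eta\in\mathbb{C}^{n}$, $$C_p(\xi,\eta):=|\xi|^p-|\xi-\eta|^p-p|\xi-\eta|^{p-2}\,\mathrm{Re}\big((\xi-\eta)\cdot\overline{\eta}\big)\ \ (\geq0),$$ the last term being read as $0$ when $\xi=\eta$. *)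

theory Defs
  imports "HOL-Analysis.Analysis"
begin

text \<open>
  A point of \<open>\<real>\<^sup>m \<times> \<real>\<^sup>k\<close> is a pair of type \<open>(real^'m) \<times> (real^'k)\<close>, with \<open>m = CARD('m)\<close> and
  \<open>k = CARD('k)\<close>; the index types are finite and nonempty, so \<open>m, k \<ge> 1\<close>. Gradients of
  complex-valued functions lie in \<open>\<complex>\<^sup>n\<close>, \<open>n = m + k\<close>, which is \<open>complex^('m + 'k)\<close>: the index
  \<open>Inl i\<close> refers to \<open>x\<^sub>i\<close> and \<open>Inr j\<close> to \<open>y\<^sub>j\<close>.

  Since \<open>0 powr a = 0\<close> for every \<open>a\<close>, also for \<open>a = 0\<close>, the power \<open>\<bar>x\<bar>\<^sup>\<gamma>\<close> and the weight
  \<open>\<rho>\<^sup>\<gamma>\<^sup>p / \<bar>x\<bar>\<^sup>\<gamma>\<^sup>p\<close> take the value \<open>0\<close> instead of \<open>1\<close> at points with \<open>x = 0\<close> when \<open>\<gamma> = 0\<close>.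
  Those points form a null set, and functions with compact support in \<open>{x \<noteq> 0}\<close> vanish near them.
\<close>

text \<open>On an open set, \<open>Ck_on k S f\<close> says that \<open>f\<close> is of class \<open>C\<^sup>k\<close> over the reals: all iterated
  directional derivatives up to order \<open>k\<close> exist and are continuous.\<close>

primrec Ck_on ::
  "nat \<Rightarrow> 'a::real_normed_vector set \<Rightarrow> ('a \<Rightarrow> 'b::real_normed_vector) \<Rightarrow> bool" where
  "Ck_on 0 S f \<longleftrightarrow> continuous_on S f"
| "Ck_on (Suc k) S f \<longleftrightarrow>
     (\<forall>z\<in>S. f differentiable (at z)) \<and> (\<forall>v. Ck_on k S (\<lambda>z. frechet_derivative f (at z) v))"

definition smooth_on ::
  "'a::real_normed_vector set \<Rightarrow> ('a \<Rightarrow> 'b::real_normed_vector) \<Rightarrow> bool" where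
  "smooth_on S f \<longleftrightarrow> (\<forall>k. Ck_on k S f)"

text \<open>The space \<open>C\<^sub>0\<^sup>\<infinity>(\<Omega>)\<close>, for open \<open>\<Omega>\<close>; its elements are extended by zero to the whole space.\<close>

definition C0_infinity ::
  "'a::real_normed_vector set \<Rightarrow> ('a \<Rightarrow> 'b::real_normed_vector) set" where
  "C0_infinity \<Omega> =
     {f. smooth_on \<Omega> f \<and> compact (closure {z. f z \<noteq> 0}) \<and> closure {z. f z \<noteq> 0} \<subseteq> \<Omega>}"

definition bg_grad ::
  "real \<Rightarrow> ((real^'m) \<times> (real^'k) \<Rightarrow> complex) \<Rightarrow> (real^'m) \<times> (real^'k) \<Rightarrow> complex^('m + 'k)" where
  "bg_grad \<gamma> f z =
     (\<chi> i. case i of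
        Inl a \<Rightarrow> frechet_derivative f (at z) (axis a 1, 0)
      | Inr b \<Rightarrow> of_real (norm (fst z) powr \<gamma>) * frechet_derivative f (at z) (0, axis b 1))"

definition hom_dim :: "nat \<Rightarrow> nat \<Rightarrow> real \<Rightarrow> real" where
  "hom_dim m k \<gamma> = real m + (1 + \<gamma>) * real k"

definition bg_rho :: "real \<Rightarrow> (real^'m) \<times> (real^'k) \<Rightarrow> real" where
  "bg_rho \<gamma> z =
     (norm (fst z) powr (2 * (1 + \<gamma>)) + (1 + \<gamma>)\<^sup>2 * (norm (snd z))\<^sup>2) powr (1 / (2 * (1 + \<gamma>)))"

definition bg_weight :: "real \<Rightarrow> real \<Rightarrow> (real^'m) \<times> (real^'k) \<Rightarrow> real" where
  "bg_weight \<gamma> p z = bg_rho \<gamma> z powr (\<gamma> * p) / norm (fst z) powr (\<gamma> * p)"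

text \<open>For \<open>\<xi> = \<eta>\<close> the last term is \<open>0\<close>, since \<open>0 powr (p - 2) = 0\<close> for all \<open>p\<close>.\<close>

definition Cp :: "real \<Rightarrow> complex^'n \<Rightarrow> complex^'n \<Rightarrow> real" where
  "Cp p \<xi> \<eta> = norm \<xi> powr p - norm (\<xi> - \<eta>) powr p
     - p * norm (\<xi> - \<eta>) powr (p - 2) * Re (\<Sum>i\<in>UNIV. (\<xi> - \<eta>) $ i * cnj (\<eta> $ i))"

definition conj_exp :: "real \<Rightarrow> real" where
  "conj_exp p = p / (p - 1)"

definition bg_alpha :: "real \<Rightarrow> real \<Rightarrow> ((real^'m) \<times> (real^'k) \<Rightarrow> complex) \<Rightarrow> real" where
  "bg_alpha p \<gamma> f =
     hom_dim CARD('m) CARD('k) \<gamma> / p * ((p - 1) / p) *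
     ((\<integral>z. norm (f z) powr p \<partial>lborel) /
      (\<integral>z. bg_rho \<gamma> z powr conj_exp p * norm (f z) powr p \<partial>lborel))"

definition bg_gauss :: "real \<Rightarrow> real \<Rightarrow> real \<Rightarrow> (real^'m) \<times> (real^'k) \<Rightarrow> real" where
  "bg_gauss \<alpha> p \<gamma> z = exp (- \<alpha> * bg_rho \<gamma> z powr conj_exp p)"

end

theory Submission
  imports Defs
begin

text \<open>
  Write \<open>g\<close> for the Gaussian with exponent \<open>\<alpha>\<close>, \<open>\<xi> = \<nabla>\<^sub>\<gamma> f\<close>, \<open>\<eta> = g \<nabla>\<^sub>\<gamma> (f / g)\<close>, and \<open>w\<close> for the weight
  \<open>\<rho>\<^sup>\<gamma>\<^sup>p / |x|\<^sup>\<gamma>\<^sup>p\<close>. The difference \<open>\<zeta> = \<xi> - \<eta> = f \<nabla>\<^sub>\<gamma> g / g\<close> is an explicit multiple of \<open>f \<nabla>\<^sub>\<gamma> \<rho>\<close>, and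

    \<open>C\<^sub>p(\<xi>, \<eta>) = |\<xi>|\<^sup>p + (p - 1) |\<zeta>|\<^sup>p - p |\<zeta>|\<^sup>p\<^sup>-\<^sup>2 Re (\<zeta> \<cdot> cnj \<xi>)\<close>.

  Since \<open>|\<nabla>\<^sub>\<gamma> \<rho>| = |x|\<^sup>\<gamma> / \<rho>\<^sup>\<gamma>\<close>, multiplication by \<open>w\<close> removes the singular powers. With \<open>\<kappa> = \<alpha> p'\<close> and
  \<open>\<tau>\<close> for \<open>\<rho>\<close> to the power \<open>p'\<close>, the second term becomes \<open>(p - 1) \<kappa>\<^sup>p \<tau> |f|\<^sup>p\<close>. In the third term all powers
  of \<open>\<rho>\<close> and \<open>|x|\<close> cancel, and it becomes \<open>\<kappa>\<^sup>p\<^sup>-\<^sup>1\<close> times the derivative of \<open>|f|\<^sup>p\<close> along the Euler field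
  \<open>x \<cdot> \<partial>\<^sub>x + (1 + \<gamma>) y \<cdot> \<partial>\<^sub>y\<close>. This is \<open>weighted_Cp_pointwise\<close>.

  The divergence of the Euler field is the constant \<open>Q\<close>, so integration by parts
  (\<open>integral_anisotropic_euler_field\<close>) turns the third term into \<open>- Q \<kappa>\<^sup>p\<^sup>-\<^sup>1 A\<close>, where \<open>A = \<integral> |f|\<^sup>p\<close>.
  Hence, with \<open>B = \<integral> \<tau> |f|\<^sup>p\<close>,

    \<open>\<integral> w C\<^sub>p(\<xi>, \<eta>) = \<integral> w |\<nabla>\<^sub>\<gamma> f|\<^sup>p + (p - 1) \<kappa>\<^sup>p B - Q \<kappa>\<^sup>p\<^sup>-\<^sup>1 A\<close>.

  The choice of \<open>\<alpha>\<close> means \<open>\<kappa> = (Q / p) (A / B)\<close>. Inserting it, the last two terms add up to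
  \<open>- (Q / p)\<^sup>p A\<^sup>p / B\<^sup>p\<^sup>-\<^sup>1\<close>, and multiplication by \<open>B\<^sup>p\<^sup>-\<^sup>1\<close> gives the claim.
\<close>

section \<open>Powers of the norm, and functions of compact support\<close>

text \<open>
  Away from the origin this is the chain rule. At the origin the formula gives \<open>0\<close>, and
  \<open>|h|\<^sup>p = o(|h|)\<close> because \<open>p > 1\<close>. Having the formula at zeros as well makes \<open>|f|\<^sup>p\<close>
  differentiable everywhere, even when \<open>p < 2\<close>.
\<close>

lemma has_derivative_norm_powr:
  fixes w :: "'a::real_inner"
  assumes "1 < p"
  shows "((\<lambda>w. norm w powr p) has_derivative (\<lambda>h. p * norm w powr (p - 2) * (w \<bullet> h))) (at w)"
proof (cases "w = 0")
  case False
  have "((\<lambda>w. norm w powr p) has_derivative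
          (\<lambda>h. norm w powr p * (0 * ln (norm w) + (h \<bullet> sgn w) * p / norm w))) (at w)"
    using False by (intro has_derivative_powr has_derivative_norm has_derivative_const) auto
  also have "(\<lambda>h. norm w powr p * (0 * ln (norm w) + (h \<bullet> sgn w) * p / norm w))
      = (\<lambda>h. p * norm w powr (p - 2) * (w \<bullet> h))"
    using False
    by (auto simp: fun_eq_iff sgn_div_norm powr_diff inner_commute power2_eq_square field_simps)
  finally show ?thesis .
next
  case True
  have "((\<lambda>h::'a. norm h powr (p - 1)) \<longlongrightarrow> norm (0::'a) powr (p - 1)) (at 0)"
    using assms by (intro tendsto_powr' tendsto_norm tendsto_ident_at tendsto_const) auto
  then have "((\<lambda>h::'a. norm h powr (p - 1)) \<longlongrightarrow> 0) (at 0)"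
    using assms by simp
  moreover have "norm h powr (p - 1) = norm (norm h powr p) / norm h" for h :: 'a
    by (cases "h = 0") (auto simp: powr_diff)
  ultimately have "((\<lambda>h::'a. norm (norm h powr p) / norm h) \<longlongrightarrow> 0) (at 0)"
    by simp
  then show ?thesis
    using True assms by (simp add: has_derivative_at)
qed

lemma integrable_lborel_compact_support:
  fixes g :: "'a::euclidean_space \<Rightarrow> real"
  assumes "continuous_on UNIV g" "compact K" "\<And>z. z \<notin> K \<Longrightarrow> g z = 0"
  shows "integrable lborel g"
proof -
  have "integrable lborel (\<lambda>z. indicator K z *\<^sub>R g z)"
    using assms by (intro borel_integrable_compact) (auto intro: continuous_on_subset)
  moreover have "(\<lambda>z. indicator K z *\<^sub>R g z) = g"
    using assms(3) by (auto simp: fun_eq_iff indicator_def)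
  ultimately show ?thesis by simp
qed

lemma continuous_on_extend_by_zero:
  fixes g :: "'a::topological_space \<Rightarrow> 'b::{topological_space, zero}"
  assumes "open \<Omega>" "closed K" "K \<subseteq> \<Omega>" "continuous_on \<Omega> g" "\<And>z. z \<notin> K \<Longrightarrow> g z = 0"
  shows "continuous_on UNIV g"
proof -
  have "continuous_on (- K) g"
    using assms(5) by (intro continuous_on_eq[OF continuous_on_const[of "- K" "0::'b"]]) auto
  then have "continuous_on (\<Omega> \<union> - K) g"
    using assms by (intro continuous_on_open_Un) auto
  moreover have "\<Omega> \<union> - K = UNIV" using assms(3) by auto
  ultimately show ?thesis by simp
qed

lemma integral_pos_of_continuous:
  fixes g :: "'a::euclidean_space \<Rightarrow> real"
  assumes "continuous_on UNIV g" "integrable lborel g" "\<And>z. 0 \<le> g z" "g a \<noteq> 0"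
  shows "0 < (\<integral>z. g z \<partial>lborel)"
proof (rule ccontr)
  assume "\<not> ?thesis"
  moreover have "0 \<le> (\<integral>z. g z \<partial>lborel)" using assms by (intro integral_nonneg_AE) auto
  ultimately have "(\<integral>z. g z \<partial>lborel) = 0" by simp
  then have "AE z in lborel. g z = 0"
    using assms by (subst (asm) integral_nonneg_eq_0_iff_AE) auto
  moreover have op: "open {z. g z \<noteq> 0}"
    using assms(1) by (intro open_Collect_neq) auto
  ultimately have "{z. g z \<noteq> 0} \<in> null_sets lborel"
    by (subst (asm) AE_iff_null) (auto intro: borel_open)
  then have "negligible {z. g z \<noteq> 0}"
    by (simp add: negligible_iff_null_sets null_sets_completionI)
  with op assms(4) show False
    using open_not_negligible by blast
qed

text \<open>
  On the support, derivatives exist because the support lies in \<open>\<Omega>\<close>; off the support, \<open>f\<close> vanishes on an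
  open set. Thus \<open>f\<close> is differentiable on the whole space, although smoothness is assumed on \<open>\<Omega>\<close> alone.
\<close>

lemma C0_infinity_derivative_facts:
  assumes f: "f \<in> C0_infinity \<Omega>"
  obtains K where "compact K" "K \<subseteq> \<Omega>" "\<And>z. z \<notin> K \<Longrightarrow> f z = 0"
    "\<And>z. z \<notin> K \<Longrightarrow> frechet_derivative f (at z) = (\<lambda>_. 0)"
    "\<And>z. (f has_derivative frechet_derivative f (at z)) (at z)"
    "\<And>v. continuous_on \<Omega> (\<lambda>z. frechet_derivative f (at z) v)"
proof -
  obtain K where K: "K = closure {z. f z \<noteq> 0}" by simp
  then have "compact K" "K \<subseteq> \<Omega>" "closed K" using f by (simp_all add: C0_infinity_def)
  moreover have off: "f z = 0" if "z \<notin> K" for z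
    using that closure_subset[of "{z. f z \<noteq> 0}"] by (auto simp: K)
  have zero: "(f has_derivative (\<lambda>_. 0)) (at z)" if "z \<notin> K" for z
    using has_derivative_const \<open>closed K\<close>[unfolded closed_def]
    by (rule has_derivative_transform_within_open) (simp_all add: that off)
  then have "frechet_derivative f (at z) = (\<lambda>_. 0)" if "z \<notin> K" for z
    using that by (metis frechet_derivative_at)
  moreover have "Ck_on (Suc 0) \<Omega> f" using f by (simp only: C0_infinity_def smooth_on_def mem_Collect_eq)
  then have d: "\<forall>z\<in>\<Omega>. f differentiable (at z)"
    and c: "\<And>v. continuous_on \<Omega> (\<lambda>z. frechet_derivative f (at z) v)"
    by simp_all
  moreover have "(f has_derivative frechet_derivative f (at z)) (at z)" for z
    using d zero[of z] \<open>K \<subseteq> \<Omega>\<close> by (metis differentiableI frechet_derivative_works subsetD)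
  ultimately show thesis using that off by blast
qed

section \<open>Integration by parts along linear vector fields\<close>

text \<open>
  Translation invariance replaces Fubini: every difference quotient of \<open>F\<close> in the direction \<open>b\<close>
  has integral \<open>0\<close>. By the mean value theorem the quotients are bounded by \<open>C\<close>, and they vanish
  outside a fixed ball, so dominated convergence carries the zero integral over to the derivative.
\<close>

lemma integral_directional_derivative:
  fixes F :: "'a::euclidean_space \<Rightarrow> real"
  assumes der: "\<And>z. (F has_derivative F' z) (at z)"
    and bound: "\<And>z. \<bar>F' z b\<bar> \<le> C" and supp: "\<And>z. R < norm z \<Longrightarrow> F z = 0"
  shows "integrable lborel (\<lambda>z. F' z b)" "(\<integral>z. F' z b \<partial>lborel) = 0"
proof -
  \<comment> \<open>Step sizes at most \<open>1\<close> keep the supports of all difference quotients in one ball.\<close>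
  define s where "s n = 1 / real (Suc n)" for n
  have s: "0 < s n" "s n \<le> 1" for n by (auto simp: s_def)
  define G where "G n z = (F (z + s n *\<^sub>R b) - F z) / s n" for n z
  have cont: "continuous_on UNIV F"
    using der by (meson has_derivative_continuous_on has_derivative_at_withinI)
  then have meas[measurable]: "F \<in> borel_measurable borel"
    by (rule borel_measurable_continuous_onI)
  have line: "((\<lambda>t. F (z + t *\<^sub>R b)) has_real_derivative F' (z + t *\<^sub>R b) b) (at t)" for z t
  proof -
    have "((\<lambda>t. F (z + t *\<^sub>R b)) has_derivative (\<lambda>h. F' (z + t *\<^sub>R b) (h *\<^sub>R b))) (at t)"
      by (rule has_derivative_compose[OF _ der]) (auto intro!: derivative_eq_intros)
    then show ?thesis
      using has_derivative_linear[OF der] by (simp add: has_field_derivative_def linear_cmul mult_commute_abs)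
  qed
  have lim: "(\<lambda>n. G n z) \<longlonglongrightarrow> F' z b" for z
  proof -
    have "((\<lambda>h. (F (z + h *\<^sub>R b) - F z) / h) \<longlongrightarrow> F' z b) (at 0)"
      using line[of z 0] by (simp add: DERIV_def)
    moreover have "filterlim s (at 0) sequentially"
      unfolding filterlim_at using s(1) LIMSEQ_inverse_real_of_nat
      by (auto simp: s_def[abs_def] inverse_eq_divide)
    ultimately show ?thesis
      unfolding G_def by (rule filterlim_compose)
  qed
  have G_bound: "\<bar>G n z\<bar> \<le> C * indicator (cball 0 (R + norm b)) z" for n z
  proof (cases "z \<in> cball 0 (R + norm b)")
    case True
    obtain t where "F (z + s n *\<^sub>R b) - F (z + 0 *\<^sub>R b) = (s n - 0) * F' (z + t *\<^sub>R b) b"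
      using MVT2[OF s(1) line] by blast
    then have "G n z = F' (z + t *\<^sub>R b) b"
      using s(1)[of n] by (simp add: G_def)
    then show ?thesis using True bound by simp
  next
    case False
    then have *: "R + norm b < norm z" by simp
    have "norm (s n *\<^sub>R b) \<le> norm b"
      using s[of n] by (simp add: mult_left_le_one_le)
    then have "R < norm (z + s n *\<^sub>R b)"
      using * norm_triangle_ineq2[of z "- s n *\<^sub>R b"] by simp
    moreover have "R < norm z" using * norm_ge_zero[of b] by linarith
    ultimately show ?thesis using False by (simp add: G_def supp)
  qed
  have w: "integrable lborel (\<lambda>z. C * indicator (cball 0 (R + norm b)) z :: real)"
    by (intro integrable_mult_right integrable_real_indicator emeasure_lborel_cball_finite) auto
  have meas_G: "G n \<in> borel_measurable borel" for n
    unfolding G_def[abs_def] by measurable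
  then have meas_lim: "(\<lambda>z. F' z b) \<in> borel_measurable borel"
    by (rule borel_measurable_LIMSEQ_metric[OF _ lim])
  show "integrable lborel (\<lambda>z. F' z b)"
    by (rule integrable_dominated_convergence[OF _ _ w, of _ G])
      (use meas_G meas_lim lim G_bound in auto)
  have "(\<lambda>n. \<integral>z. G n z \<partial>lborel) \<longlonglongrightarrow> (\<integral>z. F' z b \<partial>lborel)"
    by (rule integral_dominated_convergence[OF _ _ w])
      (use meas_G meas_lim lim G_bound in auto)
  moreover have "(\<integral>z. G n z \<partial>lborel) = 0" for n
  proof -
    have iF: "integrable lborel F"
      using cont supp by (intro integrable_lborel_compact_support[of F "cball 0 R"]) auto
    have "integrable (distr lborel borel ((+) (s n *\<^sub>R b))) F"
      using iF by (simp add: lborel_distr_plus)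
    then have i2: "integrable lborel (\<lambda>z. F (z + s n *\<^sub>R b))"
      by (subst (asm) integrable_distr_eq) (auto simp: add.commute)
    have "(\<integral>z. F z \<partial>lborel) = (\<integral>z. F z \<partial>distr lborel borel ((+) (s n *\<^sub>R b)))"
      by (simp add: lborel_distr_plus)
    also have "\<dots> = (\<integral>z. F (z + s n *\<^sub>R b) \<partial>lborel)"
      by (subst integral_distr) (auto simp: add.commute)
    finally show ?thesis
      unfolding G_def using iF i2 by simp
  qed
  ultimately show "(\<integral>z. F' z b \<partial>lborel) = 0"
    by (simp add: LIMSEQ_const_iff)
qed

text \<open>
  Integration by parts against the linear vector field with components \<open>c\<^sub>b z\<^sub>b\<close>, whose divergence is
  \<open>\<Sum>\<^sub>b c\<^sub>b\<close>: for each coordinate, the derivative of \<open>z\<^sub>b u(z)\<close> in the direction \<open>b\<close> is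
  \<open>u + z\<^sub>b \<partial>\<^sub>b u\<close> and integrates to \<open>0\<close>.
\<close>

lemma integral_diagonal_field:
  fixes u :: "'a::euclidean_space \<Rightarrow> real" and c :: "'a \<Rightarrow> real"
  assumes der: "\<And>z. (u has_derivative u' z) (at z)"
    and bound: "\<And>z b. b \<in> Basis \<Longrightarrow> \<bar>u' z b\<bar> \<le> C"
    and supp: "\<And>z. R < norm z \<Longrightarrow> u z = 0"
  shows "integrable lborel (\<lambda>z. u' z (\<Sum>b\<in>Basis. (c b * (z \<bullet> b)) *\<^sub>R b))"
    and "(\<integral>z. u' z (\<Sum>b\<in>Basis. (c b * (z \<bullet> b)) *\<^sub>R b) \<partial>lborel)
           = - (\<Sum>b\<in>Basis. c b) * (\<integral>z. u z \<partial>lborel)"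
proof -
  have cont: "continuous_on UNIV u"
    using der by (meson has_derivative_continuous_on has_derivative_at_withinI)
  have iu: "integrable lborel u"
    using cont supp by (intro integrable_lborel_compact_support[of u "cball 0 R"]) auto
  have "compact (u ` cball 0 R)"
    using cont by (intro compact_continuous_image) (auto intro: continuous_on_subset)
  then obtain M where M: "\<And>z. z \<in> cball 0 R \<Longrightarrow> \<bar>u z\<bar> \<le> M"
    by (force simp: bounded_iff dest!: compact_imp_bounded)
  have u_bound: "\<bar>u z\<bar> \<le> \<bar>M\<bar>" for z
    using M[of z] supp[of z] by (cases "z \<in> cball 0 R") auto
  have off: "u' z b = 0" if "R < norm z" for z b
  proof -
    have "open {z::'a. R < norm z}" by (intro open_Collect_less continuous_intros)
    then have "(u has_derivative (\<lambda>_. 0)) (at z)"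
      using that supp by (intro has_derivative_transform_within_open[OF has_derivative_const[of 0]]) auto
    then show ?thesis using has_derivative_unique[OF der] by metis
  qed
  have one: "integrable lborel (\<lambda>z. (z \<bullet> b) * u' z b)"
       "(\<integral>z. (z \<bullet> b) * u' z b \<partial>lborel) = - (\<integral>z. u z \<partial>lborel)" if b: "b \<in> Basis" for b
  proof -
    define F' where "F' z h = (z \<bullet> b) * u' z h + (h \<bullet> b) * u z" for z h
    have F: "((\<lambda>z. (z \<bullet> b) * u z) has_derivative F' z) (at z)" for z
      unfolding F'_def[abs_def] by (intro has_derivative_mult der has_derivative_inner_left has_derivative_ident)
    have bnd: "\<bar>F' z b\<bar> \<le> \<bar>R\<bar> * \<bar>C\<bar> + \<bar>M\<bar>" for z
    proof -
      have "\<bar>(z \<bullet> b) * u' z b\<bar> \<le> \<bar>R\<bar> * \<bar>C\<bar>"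
      proof (cases "R < norm z")
        case True then show ?thesis by (simp add: off)
      next
        case False
        then have "\<bar>z \<bullet> b\<bar> \<le> \<bar>R\<bar>" using Basis_le_norm[OF b, of z] by linarith
        moreover have "\<bar>u' z b\<bar> \<le> \<bar>C\<bar>" using bound[OF b, of z] by linarith
        ultimately show ?thesis by (simp add: abs_mult mult_mono)
      qed
      moreover have "\<bar>(b \<bullet> b) * u z\<bar> \<le> \<bar>M\<bar>" using b u_bound by simp
      ultimately show ?thesis unfolding F'_def by linarith
    qed
    have "integrable lborel (\<lambda>z. F' z b)" "(\<integral>z. F' z b \<partial>lborel) = 0"
      using integral_directional_derivative[OF F bnd, of R] supp by auto
    moreover have eq: "F' z b = (z \<bullet> b) * u' z b + u z" for z
      using b by (simp add: F'_def)
    ultimately have F1: "integrable lborel (\<lambda>z. (z \<bullet> b) * u' z b + u z)"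
       and F2: "(\<integral>z. (z \<bullet> b) * u' z b + u z \<partial>lborel) = 0" by simp_all
    show i: "integrable lborel (\<lambda>z. (z \<bullet> b) * u' z b)"
      using Bochner_Integration.integrable_diff[OF F1 iu] by simp
    show "(\<integral>z. (z \<bullet> b) * u' z b \<partial>lborel) = - (\<integral>z. u z \<partial>lborel)"
      using F2 Bochner_Integration.integral_add[OF i iu] by simp
  qed
  have expand: "u' z (\<Sum>b\<in>Basis. (c b * (z \<bullet> b)) *\<^sub>R b) = (\<Sum>b\<in>Basis. c b * ((z \<bullet> b) * u' z b))" for z
    using has_derivative_linear[OF der[of z]]
    by (simp add: linear_sum linear_cmul mult.assoc)
  show "integrable lborel (\<lambda>z. u' z (\<Sum>b\<in>Basis. (c b * (z \<bullet> b)) *\<^sub>R b))"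
    unfolding expand using one by (intro Bochner_Integration.integrable_sum integrable_mult_right) auto
  show "(\<integral>z. u' z (\<Sum>b\<in>Basis. (c b * (z \<bullet> b)) *\<^sub>R b) \<partial>lborel)
           = - (\<Sum>b\<in>Basis. c b) * (\<integral>z. u z \<partial>lborel)"
    unfolding expand using one
    by (subst Bochner_Integration.integral_sum) (auto simp: sum_distrib_right sum_negf)
qed

text \<open>
  The field \<open>x \<cdot> \<partial>\<^sub>x + (1 + \<gamma>) y \<cdot> \<partial>\<^sub>y\<close> generates the dilations of the Baouendi-Grushin geometry,
  and its divergence is the homogeneous dimension \<open>Q\<close>, the rate at which these dilations change volume.
\<close>

lemma integral_anisotropic_euler_field:
  fixes u :: "(real^'m::finite) \<times> (real^'k::finite) \<Rightarrow> real"
  assumes der: "\<And>z. (u has_derivative u' z) (at z)"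
    and bound: "\<And>z b. b \<in> Basis \<Longrightarrow> \<bar>u' z b\<bar> \<le> C"
    and supp: "\<And>z. R < norm z \<Longrightarrow> u z = 0"
  shows "integrable lborel (\<lambda>z. u' z (fst z, (1 + \<gamma>) *\<^sub>R snd z))"
    and "(\<integral>z. u' z (fst z, (1 + \<gamma>) *\<^sub>R snd z) \<partial>lborel)
           = - hom_dim CARD('m) CARD('k) \<gamma> * (\<integral>z. u z \<partial>lborel)"
proof -
  define c :: "(real^'m) \<times> (real^'k) \<Rightarrow> real" where "c b = (if snd b = 0 then 1 else 1 + \<gamma>)" for b
  have inj: "inj_on (\<lambda>u::real^'m. (u, 0::real^'k)) Basis" "inj_on (\<lambda>v::real^'k. (0::real^'m, v)) Basis"
    by (auto intro: inj_onI)
  have split: "sum g Basis = (\<Sum>i\<in>Basis. g (i, 0)) + (\<Sum>j\<in>Basis. g (0, j))"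
    for g :: "(real^'m) \<times> (real^'k) \<Rightarrow> 'c::comm_monoid_add"
    unfolding Basis_prod_def
    by (subst sum.union_disjoint) (auto simp: sum.reindex[OF inj(1)] sum.reindex[OF inj(2)] nonzero_Basis)
  have field: "(\<Sum>b\<in>Basis. (c b * (z \<bullet> b)) *\<^sub>R b) = (fst z, (1 + \<gamma>) *\<^sub>R snd z)" for z
  proof -
    have "(\<Sum>b\<in>Basis. (c b * (z \<bullet> b)) *\<^sub>R b)
       = (\<Sum>i\<in>Basis. ((fst z \<bullet> i) *\<^sub>R i, 0)) + (\<Sum>j\<in>Basis. (0, (1 + \<gamma>) *\<^sub>R (snd z \<bullet> j) *\<^sub>R j))"
      unfolding split by (intro arg_cong2[of _ _ _ _ "(+)"] sum.cong) (auto simp: c_def nonzero_Basis inner_prod_def)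
    also have "\<dots> = (fst z, (1 + \<gamma>) *\<^sub>R snd z)"
      by (rule prod_eqI)
        (simp_all add: fst_sum snd_sum euclidean_representation flip: scaleR_sum_right del: scaleR_scaleR)
    finally show ?thesis .
  qed
  have "(\<Sum>b\<in>Basis. c b) = (\<Sum>i\<in>(Basis::(real^'m) set). 1) + (\<Sum>j\<in>(Basis::(real^'k) set). 1 + \<gamma>)"
    unfolding split by (intro arg_cong2[of _ _ _ _ "(+)"] sum.cong) (auto simp: c_def nonzero_Basis)
  then have dim: "(\<Sum>b\<in>Basis. c b) = hom_dim CARD('m) CARD('k) \<gamma>"
    by (simp add: hom_dim_def algebra_simps)
  show "integrable lborel (\<lambda>z. u' z (fst z, (1 + \<gamma>) *\<^sub>R snd z))"
    using integral_diagonal_field(1)[OF assms, where c = c] by (simp add: field)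
  show "(\<integral>z. u' z (fst z, (1 + \<gamma>) *\<^sub>R snd z) \<partial>lborel)
           = - hom_dim CARD('m) CARD('k) \<gamma> * (\<integral>z. u z \<partial>lborel)"
    using integral_diagonal_field(2)[OF assms, where c = c] by (simp add: field dim)
qed

section \<open>Algebra of the remainder functional\<close>

text \<open>
  Substituting \<open>\<eta> = \<xi> - (\<xi> - \<eta>)\<close> in the last term of \<open>C\<^sub>p\<close> leaves only \<open>\<xi>\<close> and \<open>\<zeta> = \<xi> - \<eta>\<close>. In the
  application \<open>\<zeta>\<close> carries no derivative of \<open>f\<close>, so the second term has order zero and the third one
  is linear in the gradient of \<open>f\<close>. The real part of the Hermitian product is the real inner product
  of the type \<open>complex^'n\<close>.
\<close>

lemma Cp_eq_inner:
  "Cp p \<xi> \<eta> = norm \<xi> powr p + (p - 1) * norm (\<xi> - \<eta>) powr p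
     - p * norm (\<xi> - \<eta>) powr (p - 2) * ((\<xi> - \<eta>) \<bullet> \<xi>)"
proof -
  have inner: "Re (\<Sum>i\<in>UNIV. x $ i * cnj (y $ i)) = x \<bullet> y" for x y :: "complex^'n"
    by (simp add: inner_vec_def inner_complex_def)
  have "(\<xi> - \<eta>) \<bullet> \<eta> = (\<xi> - \<eta>) \<bullet> \<xi> - (\<xi> - \<eta>) \<bullet> (\<xi> - \<eta>)"
    by (simp add: inner_diff_right)
  then have "(\<xi> - \<eta>) \<bullet> \<eta> = (\<xi> - \<eta>) \<bullet> \<xi> - (norm (\<xi> - \<eta>))\<^sup>2"
    by (simp add: power2_norm_eq_inner)
  moreover have "norm (\<xi> - \<eta>) powr (p - 2) * (norm (\<xi> - \<eta>))\<^sup>2 = norm (\<xi> - \<eta>) powr p"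
    by (cases "\<xi> = \<eta>") (auto simp: powr_diff)
  ultimately have "norm (\<xi> - \<eta>) powr (p - 2) * ((\<xi> - \<eta>) \<bullet> \<eta>)
      = norm (\<xi> - \<eta>) powr (p - 2) * ((\<xi> - \<eta>) \<bullet> \<xi>) - norm (\<xi> - \<eta>) powr p"
    by (simp add: right_diff_distrib)
  then show ?thesis
    unfolding Cp_def inner mult.assoc by (simp add: right_diff_distrib left_diff_distrib)
qed

lemma sum_UNIV_sum_type:
  "(\<Sum>i\<in>UNIV. g i) = (\<Sum>a\<in>UNIV. g (Inl a)) + (\<Sum>b\<in>UNIV. g (Inr b))"
  for g :: "'a::finite + 'b::finite \<Rightarrow> 'c::comm_monoid_add"
  by (subst UNIV_Plus_UNIV[symmetric], subst sum.Plus) (auto simp: o_def)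

section \<open>The gauge function and its gradient\<close>

text \<open>
  This is \<open>\<rho>\<^sup>1\<^sup>+\<^sup>2\<^sup>\<gamma> \<nabla>\<^sub>\<gamma> \<rho>\<close>. Clearing the power of \<open>\<rho>\<close> makes the components polynomial in the
  coordinates up to powers of \<open>|x|\<close>, and every function of \<open>\<rho>\<close> has a \<open>\<gamma>\<close>-gradient parallel to it.
\<close>

definition bg_field :: "real \<Rightarrow> (real^'m) \<times> (real^'k) \<Rightarrow> complex^('m + 'k)" where
  "bg_field \<gamma> z =
     (\<chi> i. case i of
        Inl a \<Rightarrow> of_real (norm (fst z) powr (2 * \<gamma>) * fst z $ a)
      | Inr b \<Rightarrow> of_real (norm (fst z) powr \<gamma> * ((1 + \<gamma>) * snd z $ b)))"

lemma bg_rho_powr: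
  "bg_rho \<gamma> z powr q =
     (norm (fst z) powr (2 * (1 + \<gamma>)) + (1 + \<gamma>)\<^sup>2 * (norm (snd z))\<^sup>2) powr (q / (2 * (1 + \<gamma>)))"
  by (simp add: bg_rho_def powr_powr)

lemma bg_rho_base_pos:
  assumes "fst z \<noteq> 0"
  shows "0 < norm (fst z) powr (2 * (1 + \<gamma>)) + (1 + \<gamma>)\<^sup>2 * (norm (snd z))\<^sup>2"
  using assms by (intro add_pos_nonneg) auto

lemma bg_rho_pos:
  assumes "fst z \<noteq> 0"
  shows "0 < bg_rho \<gamma> z"
  using bg_rho_base_pos[OF assms, of \<gamma>] by (simp add: bg_rho_def)

lemma continuous_on_bg_rho:
  assumes "0 \<le> \<gamma>"
  shows "continuous_on S (bg_rho \<gamma>)"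
  unfolding bg_rho_def[abs_def] using assms
  by (intro continuous_on_powr' continuous_intros) auto

text \<open>
  \<open>\<rho>\<close> to the power \<open>2 (1 + \<gamma>)\<close> is \<open>N(z) = |x|\<^sup>2\<^sup>+\<^sup>2\<^sup>\<gamma> + (1 + \<gamma>)\<^sup>2 |y|\<^sup>2\<close>, which is differentiable and, for
  \<open>x \<noteq> 0\<close>, positive; every power of \<open>\<rho>\<close> is a power of \<open>N\<close>.
\<close>

lemma has_derivative_bg_rho_powr:
  fixes z :: "(real^'a::finite) \<times> (real^'b::finite)"
  assumes "0 \<le> \<gamma>" "fst z \<noteq> 0"
  shows "((\<lambda>w. bg_rho \<gamma> w powr q) has_derivative
     (\<lambda>h. q * bg_rho \<gamma> z powr (q - 2 - 2 * \<gamma>) *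
        (norm (fst z) powr (2 * \<gamma>) * (fst z \<bullet> fst h) + (1 + \<gamma>) * (snd z \<bullet> snd h)))) (at z)"
proof -
  define N where "N z = norm (fst z) powr (2 * (1 + \<gamma>)) + (1 + \<gamma>)\<^sup>2 * (norm (snd z))\<^sup>2"
    for z :: "(real^'a) \<times> (real^'b)"
  have N: "0 < N z" using bg_rho_base_pos[OF assms(2)] by (simp add: N_def)
  have rho: "bg_rho \<gamma> w powr a = N w powr (a / (2 * (1 + \<gamma>)))" for w a
    by (simp only: bg_rho_powr N_def)
  define D where "D h = norm (fst z) powr (2 * \<gamma>) * (fst z \<bullet> fst h) + (1 + \<gamma>) * (snd z \<bullet> snd h)" for h
  have "((\<lambda>w. norm (fst w) powr (2 * (1 + \<gamma>))) has_derivative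
          (\<lambda>h. 2 * (1 + \<gamma>) * norm (fst z) powr (2 * (1 + \<gamma>) - 2) * (fst z \<bullet> fst h))) (at z)"
    using assms(1)
    by (intro has_derivative_compose[OF _ has_derivative_norm_powr] has_derivative_fst has_derivative_ident) auto
  moreover have "((\<lambda>w. (norm (snd w))\<^sup>2) has_derivative (\<lambda>h. 2 * (snd z \<bullet> snd h))) (at z)"
    unfolding power2_norm_eq_inner
    by (auto intro!: derivative_eq_intros simp: inner_commute)
  ultimately have "(N has_derivative (\<lambda>h. 2 * (1 + \<gamma>) * norm (fst z) powr (2 * (1 + \<gamma>) - 2) * (fst z \<bullet> fst h)
       + (1 + \<gamma>)\<^sup>2 * (2 * (snd z \<bullet> snd h)))) (at z)"
    unfolding N_def[abs_def] by (intro has_derivative_add has_derivative_mult_right)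
  also have "(\<lambda>h. 2 * (1 + \<gamma>) * norm (fst z) powr (2 * (1 + \<gamma>) - 2) * (fst z \<bullet> fst h)
       + (1 + \<gamma>)\<^sup>2 * (2 * (snd z \<bullet> snd h))) = (\<lambda>h. 2 * (1 + \<gamma>) * D h)"
    by (auto simp: fun_eq_iff D_def algebra_simps power2_eq_square)
  finally have dN: "(N has_derivative (\<lambda>h. 2 * (1 + \<gamma>) * D h)) (at z)" .
  define s where "s = q / (2 * (1 + \<gamma>))"
  have "((\<lambda>w. N w powr s) has_derivative (\<lambda>h. N z powr s * (0 * ln (N z) + 2 * (1 + \<gamma>) * D h * s / N z))) (at z)"
    using dN N by (intro has_derivative_powr has_derivative_const) auto
  moreover have "N z powr s * (0 * ln (N z) + 2 * (1 + \<gamma>) * D h * s / N z)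
      = q * bg_rho \<gamma> z powr (q - 2 - 2 * \<gamma>) * D h" for h
  proof -
    have "(q - 2 - 2 * \<gamma>) / (2 * (1 + \<gamma>)) = s - 1"
      using assms(1) by (simp add: s_def field_simps)
    then have "bg_rho \<gamma> z powr (q - 2 - 2 * \<gamma>) = N z powr s / N z"
      using N powr_diff[of "N z" s 1] by (simp only: rho powr_one)
    then show ?thesis using assms(1) by (simp add: s_def)
  qed
  ultimately have "((\<lambda>w. N w powr s) has_derivative (\<lambda>h. q * bg_rho \<gamma> z powr (q - 2 - 2 * \<gamma>) * D h)) (at z)"
    by (simp only:)
  then show ?thesis
    unfolding D_def s_def by (simp only: rho)
qed

lemma norm_vector_scalar_mult: "norm (c *s v) = norm c * norm v"
  for c :: complex and v :: "complex^'n"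
  by (simp add: norm_vec_def norm_mult L2_set_right_distrib)

text \<open>
  For \<open>x \<noteq> 0\<close> this is the identity \<open>|\<nabla>\<^sub>\<gamma> \<rho>| = |x|\<^sup>\<gamma> / \<rho>\<^sup>\<gamma>\<close>, which is why the weight
  \<open>\<rho>\<^sup>\<gamma>\<^sup>p / |x|\<^sup>\<gamma>\<^sup>p\<close> normalizes \<open>|\<nabla>\<^sub>\<gamma> \<rho>|\<^sup>p\<close> to \<open>1\<close>.
\<close>

lemma norm_bg_field:
  assumes "0 \<le> \<gamma>"
  shows "norm (bg_field \<gamma> z) = norm (fst z) powr \<gamma> * bg_rho \<gamma> z powr (1 + \<gamma>)"
proof -
  let ?t = "norm (fst z)"
  have coord: "(norm v)\<^sup>2 = (\<Sum>i\<in>UNIV. (v $ i)\<^sup>2)" for v :: "real^'n"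
    unfolding power2_norm_eq_inner inner_vec_def by (simp add: power2_eq_square)
  have "(norm (bg_field \<gamma> z))\<^sup>2 = (\<Sum>i\<in>UNIV. (norm (bg_field \<gamma> z $ i))\<^sup>2)"
    by (simp add: power2_norm_eq_inner inner_vec_def)
  also have "\<dots> = (?t powr (2 * \<gamma>))\<^sup>2 * ?t\<^sup>2 + (?t powr \<gamma>)\<^sup>2 * ((1 + \<gamma>)\<^sup>2 * (norm (snd z))\<^sup>2)"
    unfolding sum_UNIV_sum_type coord[of "fst z"] coord[of "snd z"]
    by (simp add: bg_field_def sum_distrib_left power_mult_distrib del: of_real_mult of_real_add)
  also have "\<dots> = (?t powr \<gamma>)\<^sup>2 * (?t powr (2 * (1 + \<gamma>)) + (1 + \<gamma>)\<^sup>2 * (norm (snd z))\<^sup>2)"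
  proof -
    have 1: "?t powr (2 * \<gamma>) = (?t powr \<gamma>)\<^sup>2"
      by (simp add: power2_eq_square flip: powr_add)
    have 2: "?t powr (2 * (1 + \<gamma>)) = (?t powr \<gamma>)\<^sup>2 * ?t\<^sup>2"
      by (cases "?t = 0") (simp_all add: distrib_left powr_add flip: 1)
    show ?thesis unfolding 1 2 by algebra
  qed
  also have "\<dots> = (?t powr \<gamma> * bg_rho \<gamma> z powr (1 + \<gamma>))\<^sup>2"
  proof -
    have "(1 + \<gamma>) / (2 * (1 + \<gamma>)) = 1 / 2" using assms by (simp add: field_simps)
    moreover have "0 \<le> ?t powr (2 * (1 + \<gamma>)) + (1 + \<gamma>)\<^sup>2 * (norm (snd z))\<^sup>2" by simp
    ultimately show ?thesis
      by (simp only: power_mult_distrib bg_rho_powr powr_half_sqrt real_sqrt_pow2)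
  qed
  finally show ?thesis
    by (simp add: power2_eq_iff_nonneg)
qed

text \<open>
  Both blocks of the pairing contain the same factor \<open>|x|\<^sup>2\<^sup>\<gamma>\<close>: in the \<open>x\<close> block it comes from
  \<open>bg_field\<close> alone, in the \<open>y\<close> block \<open>bg_field\<close> and \<open>bg_grad\<close> contribute \<open>|x|\<^sup>\<gamma>\<close>
  each. What remains is the derivative of \<open>f\<close> along the anisotropic Euler field.
\<close>

lemma inner_bg_field_bg_grad:
  assumes f: "f differentiable (at z)"
  shows "(c *s bg_field \<gamma> z) \<bullet> bg_grad \<gamma> f z
     = norm (fst z) powr (2 * \<gamma>) * (c \<bullet> frechet_derivative f (at z) (fst z, (1 + \<gamma>) *\<^sub>R snd z))"
proof -
  define L where "L = frechet_derivative f (at z)"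
  have L: "linear L" using f linear_frechet_derivative unfolding L_def by blast
  have pull: "(c * of_real r) \<bullet> (of_real s * y) = r * s * (c \<bullet> y)" for r s :: real and y :: complex
    by (simp add: inner_complex_def algebra_simps)
  have "(fst z, (1 + \<gamma>) *\<^sub>R snd z) = (\<Sum>a\<in>UNIV. (fst z $ a) *\<^sub>R (axis a 1, 0))
      + (\<Sum>b\<in>UNIV. ((1 + \<gamma>) * snd z $ b) *\<^sub>R (0, axis b 1))"
    using basis_expansion[of "fst z"] basis_expansion[of "(1 + \<gamma>) *\<^sub>R snd z"]
    by (intro prod_eqI) (simp_all add: fst_sum snd_sum scalar_mult_eq_scaleR)
  then have "L (fst z, (1 + \<gamma>) *\<^sub>R snd z) = (\<Sum>a\<in>UNIV. (fst z $ a) *\<^sub>R L (axis a 1, 0))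
      + (\<Sum>b\<in>UNIV. ((1 + \<gamma>) * snd z $ b) *\<^sub>R L (0, axis b 1))"
    using L by (simp only: linear_add linear_sum linear_cmul)
  then have "norm (fst z) powr (2 * \<gamma>) * (c \<bullet> L (fst z, (1 + \<gamma>) *\<^sub>R snd z))
     = (\<Sum>a\<in>UNIV. norm (fst z) powr (2 * \<gamma>) * (fst z $ a * (c \<bullet> L (axis a 1, 0))))
      + (\<Sum>b\<in>UNIV. norm (fst z) powr (2 * \<gamma>) * ((1 + \<gamma>) * snd z $ b * (c \<bullet> L (0, axis b 1))))"
    by (simp add: inner_add_right inner_sum_right sum_distrib_left distrib_left)
  moreover have "((c *s bg_field \<gamma> z) $ Inl a) \<bullet> (bg_grad \<gamma> f z $ Inl a)
      = norm (fst z) powr (2 * \<gamma>) * (fst z $ a * (c \<bullet> L (axis a 1, 0)))" for a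
    using pull[of _ 1] by (simp add: bg_field_def bg_grad_def del: of_real_mult flip: L_def)
  moreover have "((c *s bg_field \<gamma> z) $ Inr b) \<bullet> (bg_grad \<gamma> f z $ Inr b)
      = norm (fst z) powr (2 * \<gamma>) * ((1 + \<gamma>) * snd z $ b * (c \<bullet> L (0, axis b 1)))" for b
  proof -
    have "norm (fst z) powr (2 * \<gamma>) = norm (fst z) powr \<gamma> * norm (fst z) powr \<gamma>"
      by (simp flip: powr_add)
    then show ?thesis
      using pull by (simp add: bg_field_def bg_grad_def del: of_real_mult of_real_add flip: L_def)
  qed
  ultimately show ?thesis
    unfolding inner_vec_def sum_UNIV_sum_type L_def[symmetric] by simp
qed

text \<open>
  With \<open>g\<close> for the Gaussian, \<open>g \<nabla>\<^sub>\<gamma> (f / g) = \<nabla>\<^sub>\<gamma> f - f \<nabla>\<^sub>\<gamma> g / g\<close> by the quotient rule, and the logarithmic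
  gradient of \<open>g\<close> is \<open>- \<alpha>\<close> times the \<open>\<gamma>\<close>-gradient of \<open>\<rho>\<close> to the power \<open>p'\<close>.
\<close>

lemma bg_grad_div_gauss:
  fixes f :: "(real^'a::finite) \<times> (real^'b::finite) \<Rightarrow> complex"
  assumes \<gamma>: "0 \<le> \<gamma>" and z: "fst z \<noteq> 0" and f: "f differentiable (at z)"
  shows "bg_gauss \<alpha> p \<gamma> z *\<^sub>R bg_grad \<gamma> (\<lambda>w. f w / of_real (bg_gauss \<alpha> p \<gamma> w)) z
    = bg_grad \<gamma> f z
      + (of_real (\<alpha> * conj_exp p * bg_rho \<gamma> z powr (conj_exp p - 2 - 2 * \<gamma>)) * f z) *s bg_field \<gamma> z"
proof -
  define L where "L = frechet_derivative f (at z)"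
  define q where "q = conj_exp p"
  define T where "T h = q * bg_rho \<gamma> z powr (q - 2 - 2 * \<gamma>) *
        (norm (fst z) powr (2 * \<gamma>) * (fst z \<bullet> fst h) + (1 + \<gamma>) * (snd z \<bullet> snd h))" for h
  define G where "G w = exp (\<alpha> * bg_rho \<gamma> w powr q)" for w :: "(real^'a) \<times> (real^'b)"
  have quot: "(\<lambda>w. f w / of_real (bg_gauss \<alpha> p \<gamma> w)) = (\<lambda>w. f w * of_real (G w))"
    by (auto simp: fun_eq_iff bg_gauss_def G_def q_def exp_minus divide_inverse)
  have "(G has_derivative (\<lambda>h. G z * (\<alpha> * T h))) (at z)"
    unfolding G_def[abs_def] T_def
    by (rule has_derivative_eq_rhs[OF has_derivative_exp[OF has_derivative_mult_right[OF
          has_derivative_bg_rho_powr[OF \<gamma> z]]]]) auto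
  moreover have "(f has_derivative L) (at z)"
    using f by (simp add: L_def frechet_derivative_works)
  ultimately have "((\<lambda>w. f w * of_real (G w)) has_derivative
      (\<lambda>h. f z * of_real (G z * (\<alpha> * T h)) + L h * of_real (G z))) (at z)"
    by (intro has_derivative_mult has_derivative_of_real)
  then have fd: "frechet_derivative (\<lambda>w. f w * of_real (G w)) (at z)
      = (\<lambda>h. f z * of_real (G z * (\<alpha> * T h)) + L h * of_real (G z))"
    by (rule frechet_derivative_at[symmetric])
  have g: "bg_gauss \<alpha> p \<gamma> z = inverse (G z)" "G z \<noteq> 0"
    by (auto simp: bg_gauss_def G_def q_def exp_minus)
  have cancel: "bg_gauss \<alpha> p \<gamma> z *\<^sub>R (f z * of_real (G z * s) + x * of_real (G z)) = x + of_real s * f z"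
    for s and x :: complex
    unfolding g(1) scaleR_conv_of_real using g(2) by (simp add: field_simps)
  show ?thesis
    unfolding quot q_def[symmetric] vec_eq_iff
  proof
    fix i :: "'a + 'b"
    show "(bg_gauss \<alpha> p \<gamma> z *\<^sub>R bg_grad \<gamma> (\<lambda>w. f w * of_real (G w)) z) $ i =
       (bg_grad \<gamma> f z + (of_real (\<alpha> * q * bg_rho \<gamma> z powr (q - 2 - 2 * \<gamma>)) * f z) *s bg_field \<gamma> z) $ i"
    proof (cases i)
      case (Inl a)
      have "T (axis a 1, 0) = q * bg_rho \<gamma> z powr (q - 2 - 2 * \<gamma>) * (norm (fst z) powr (2 * \<gamma>) * fst z $ a)"
        by (simp add: T_def inner_axis)
      then show ?thesis
        unfolding vector_scaleR_component vector_add_component vector_smult_component Inl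
        by (simp only: bg_grad_def bg_field_def vec_lambda_beta sum.case fd cancel L_def[symmetric])
          (simp add: mult_ac)
    next
      case (Inr b)
      have "T (0, axis b 1) = q * bg_rho \<gamma> z powr (q - 2 - 2 * \<gamma>) * ((1 + \<gamma>) * snd z $ b)"
        by (simp add: T_def inner_axis)
      then show ?thesis
        unfolding vector_scaleR_component vector_add_component vector_smult_component Inr
        by (simp only: bg_grad_def bg_field_def vec_lambda_beta sum.case fd cancel L_def[symmetric]
              mult_scaleR_right[symmetric])
          (simp add: distrib_left mult_ac)
    qed
  qed
qed

section \<open>The pointwise identity for the remainder\<close>

text \<open>
  Here \<open>r\<close>, \<open>t\<close>, \<open>F\<close> stand for \<open>\<rho>\<close>, \<open>|x|\<close>, \<open>|f|\<close>, and the large bracket is \<open>|\<zeta>|\<close>. The powers of \<open>t\<close> cancel,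
  and the exponent of \<open>r\<close> collapses through \<open>(p' - 1) p = p'\<close>.
\<close>

lemma weighted_powr_norm:
  fixes r t F \<kappa> p \<gamma> :: real
  assumes "1 < p" "0 < r" "0 < t" "0 \<le> F" "0 < \<kappa>"
  shows "(r powr (\<gamma> * p) / t powr (\<gamma> * p)) *
      (\<kappa> * r powr (conj_exp p - 2 - 2 * \<gamma>) * F * (t powr \<gamma> * r powr (1 + \<gamma>))) powr p
      = \<kappa> powr p * (r powr conj_exp p * F powr p)"
proof -
  have e: "(conj_exp p - 1) * p = conj_exp p" using assms(1) by (simp add: conj_exp_def field_simps)
  have "\<gamma> * p + ((conj_exp p - 2 - 2 * \<gamma>) * p + (1 + \<gamma>) * p) = (conj_exp p - 1) * p" by algebra
  then have "r powr (\<gamma> * p) * (r powr ((conj_exp p - 2 - 2 * \<gamma>) * p) * r powr ((1 + \<gamma>) * p)) = r powr conj_exp p"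
    using e by (simp flip: powr_add)
  then show ?thesis
    using assms by (simp add: powr_mult powr_powr field_simps)
qed

text \<open>
  The companion count of exponents for the cross term. All powers of \<open>r\<close> and \<open>t\<close> cancel, by
  \<open>(p' - 1) (p - 1) = 1\<close>; this is what singles out \<open>p'\<close> as the exponent of \<open>\<rho>\<close> in the Gaussian.
\<close>

lemma weighted_powr_cross:
  fixes r t F \<kappa> p \<gamma> :: real
  assumes "1 < p" "0 < r" "0 < t" "0 \<le> F" "0 < \<kappa>"
  shows "(r powr (\<gamma> * p) / t powr (\<gamma> * p)) *
      (\<kappa> * r powr (conj_exp p - 2 - 2 * \<gamma>) * F * (t powr \<gamma> * r powr (1 + \<gamma>))) powr (p - 2)
      * (\<kappa> * r powr (conj_exp p - 2 - 2 * \<gamma>) * t powr (2 * \<gamma>))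
      = \<kappa> powr (p - 1) * F powr (p - 2)"
proof -
  let ?e = "conj_exp p - 2 - 2 * \<gamma>"
  have "(conj_exp p - 1) * (p - 1) = 1" using assms(1) by (simp add: conj_exp_def field_simps)
  then have "\<gamma> * p + (?e * (p - 2) + ((1 + \<gamma>) * (p - 2) + ?e)) = 0" by algebra
  then have r: "r powr (\<gamma> * p) * (r powr (?e * (p - 2)) * (r powr ((1 + \<gamma>) * (p - 2)) * r powr ?e)) = 1"
    using assms(2) by (simp flip: powr_add)
  have t: "t powr (\<gamma> * (p - 2)) * t powr (2 * \<gamma>) = t powr (\<gamma> * p)"
    by (simp add: algebra_simps flip: powr_add)
  have k: "\<kappa> powr (p - 2) * \<kappa> = \<kappa> powr (p - 1)"
    using assms(5) powr_add[of \<kappa> "p - 2" 1] by simp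
  have "(r powr (\<gamma> * p) / t powr (\<gamma> * p)) *
      (\<kappa> * r powr ?e * F * (t powr \<gamma> * r powr (1 + \<gamma>))) powr (p - 2)
      * (\<kappa> * r powr ?e * t powr (2 * \<gamma>))
     = (r powr (\<gamma> * p) * (r powr (?e * (p - 2)) * (r powr ((1 + \<gamma>) * (p - 2)) * r powr ?e)))
       * ((t powr (\<gamma> * (p - 2)) * t powr (2 * \<gamma>)) / t powr (\<gamma> * p))
       * (\<kappa> powr (p - 2) * \<kappa>) * F powr (p - 2)"
    using assms by (simp add: powr_mult powr_powr mult_ac)
  then show ?thesis using assms by (simp add: r t k)
qed

text \<open>
  The integrand of the remainder term splits into the weighted energy density, a multiple of
  \<open>|f|\<^sup>p\<close> weighted with \<open>\<rho>\<close> to the power \<open>p'\<close>, and a multiple of the derivative of \<open>|f|\<^sup>p\<close> along the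
  anisotropic Euler field. At zeros of \<open>f\<close> one has \<open>\<zeta> = 0\<close>, and both sides reduce to the energy density
  because \<open>0 powr a = 0\<close>.
\<close>

lemma weighted_Cp_pointwise:
  assumes p: "1 < p" and \<gamma>: "0 \<le> \<gamma>" and \<alpha>: "0 < \<alpha>"
    and z: "fst z \<noteq> 0" and f: "f differentiable (at z)"
  shows "bg_weight \<gamma> p z * Cp p (bg_grad \<gamma> f z)
            (bg_gauss \<alpha> p \<gamma> z *\<^sub>R bg_grad \<gamma> (\<lambda>w. f w / of_real (bg_gauss \<alpha> p \<gamma> w)) z)
    = bg_weight \<gamma> p z * norm (bg_grad \<gamma> f z) powr p
      + (p - 1) * (\<alpha> * conj_exp p) powr p * (bg_rho \<gamma> z powr conj_exp p * norm (f z) powr p)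
      + (\<alpha> * conj_exp p) powr (p - 1) *
        (p * norm (f z) powr (p - 2) *
          (f z \<bullet> frechet_derivative f (at z) (fst z, (1 + \<gamma>) *\<^sub>R snd z)))"
proof -
  define r t \<kappa> where "r = bg_rho \<gamma> z" and "t = norm (fst z)" and "\<kappa> = \<alpha> * conj_exp p"
  have pos: "0 < r" "0 < t" "0 < \<kappa>"
    using z bg_rho_pos[OF z] \<alpha> p by (auto simp: r_def t_def \<kappa>_def conj_exp_def)
  define e where "e = conj_exp p - 2 - 2 * \<gamma>"
  define c where "c = - (of_real (\<kappa> * r powr e) * f z)"
  define \<xi> where "\<xi> = bg_grad \<gamma> f z"
  define \<eta> where "\<eta> = bg_gauss \<alpha> p \<gamma> z *\<^sub>R bg_grad \<gamma> (\<lambda>w. f w / of_real (bg_gauss \<alpha> p \<gamma> w)) z"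
  define E where "E = f z \<bullet> frechet_derivative f (at z) (fst z, (1 + \<gamma>) *\<^sub>R snd z)"
  have \<zeta>: "\<xi> - \<eta> = c *s bg_field \<gamma> z"
    unfolding \<xi>_def \<eta>_def bg_grad_div_gauss[OF \<gamma> z f]
    by (simp add: vec_eq_iff c_def \<kappa>_def r_def e_def)
  have n: "norm (\<xi> - \<eta>) = \<kappa> * r powr e * norm (f z) * (t powr \<gamma> * r powr (1 + \<gamma>))"
    unfolding \<zeta> norm_vector_scalar_mult norm_bg_field[OF \<gamma>] using pos
    by (simp add: c_def norm_mult r_def t_def)
  have "c \<bullet> x = - (\<kappa> * r powr e) * (f z \<bullet> x)" for x
    by (simp add: c_def inner_complex_def algebra_simps)
  then have i: "(\<xi> - \<eta>) \<bullet> \<xi> = - (\<kappa> * r powr e * t powr (2 * \<gamma>)) * E"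
    unfolding \<zeta> unfolding \<xi>_def inner_bg_field_bg_grad[OF f] by (simp add: E_def t_def)
  have w: "bg_weight \<gamma> p z = r powr (\<gamma> * p) / t powr (\<gamma> * p)"
    by (simp add: bg_weight_def r_def t_def)
  have "bg_weight \<gamma> p z * Cp p \<xi> \<eta> = bg_weight \<gamma> p z * norm \<xi> powr p
     + (p - 1) * (bg_weight \<gamma> p z * norm (\<xi> - \<eta>) powr p)
     + p * (bg_weight \<gamma> p z * norm (\<xi> - \<eta>) powr (p - 2) * (\<kappa> * r powr e * t powr (2 * \<gamma>))) * E"
    unfolding Cp_eq_inner i by (simp add: algebra_simps)
  also have "\<dots> = bg_weight \<gamma> p z * norm \<xi> powr p
     + (p - 1) * (\<kappa> powr p * (r powr conj_exp p * norm (f z) powr p))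
     + p * (\<kappa> powr (p - 1) * norm (f z) powr (p - 2)) * E"
    unfolding n w e_def weighted_powr_norm[OF p pos(1,2) norm_ge_zero pos(3)]
      weighted_powr_cross[OF p pos(1,2) norm_ge_zero pos(3)] ..
  finally show ?thesis
    unfolding \<xi>_def \<eta>_def E_def \<kappa>_def r_def by (simp add: mult_ac)
qed

section \<open>The identity with remainder\<close>

theorem corollary3p13:
  fixes p \<gamma> :: real
    and f :: "(real^'m::finite) \<times> (real^'k::finite) \<Rightarrow> complex"
  assumes "1 < p" and "0 \<le> \<gamma>"
    and "f \<in> C0_infinity {z. fst z \<noteq> 0}"
    and "f \<noteq> (\<lambda>z. 0)"
  shows
    "(\<integral>z. bg_weight \<gamma> p z * norm (bg_grad \<gamma> f z) powr p \<partial>lborel)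
       * (\<integral>z. bg_rho \<gamma> z powr conj_exp p * norm (f z) powr p \<partial>lborel) powr (p - 1)
     = (hom_dim CARD('m) CARD('k) \<gamma> / p) powr p * (\<integral>z. norm (f z) powr p \<partial>lborel) powr p
       + (\<integral>z. bg_rho \<gamma> z powr conj_exp p * norm (f z) powr p \<partial>lborel) powr (p - 1)
         * (\<integral>z. bg_weight \<gamma> p z *
               Cp p (bg_grad \<gamma> f z)
                 (bg_gauss (bg_alpha p \<gamma> f) p \<gamma> z *\<^sub>R
                  bg_grad \<gamma> (\<lambda>w. f w / of_real (bg_gauss (bg_alpha p \<gamma> f) p \<gamma> w)) z) \<partial>lborel)"
proof -
  note p = assms(1) and \<gamma> = assms(2)
  define \<Omega> where "\<Omega> = {z::(real^'m) \<times> (real^'k). fst z \<noteq> 0}"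
  define Df where "Df z = frechet_derivative f (at z)" for z
  have "f \<in> C0_infinity \<Omega>" using assms(3) by (simp add: \<Omega>_def)
  from C0_infinity_derivative_facts[OF this] obtain K where K: "compact K" "K \<subseteq> \<Omega>"
    and f_off: "\<And>z. z \<notin> K \<Longrightarrow> f z = 0" and Df_off: "\<And>z. z \<notin> K \<Longrightarrow> Df z = (\<lambda>_. 0)"
    and df: "\<And>z. (f has_derivative Df z) (at z)"
    and Df_cont: "\<And>v. continuous_on \<Omega> (\<lambda>z. Df z v)"
    unfolding Df_def by blast
  have open_\<Omega>: "open \<Omega>" unfolding \<Omega>_def by (intro open_Collect_neq continuous_intros)
  have f_cont: "continuous_on UNIV f"
    using df by (meson has_derivative_continuous_on has_derivative_at_withinI)
  define u where "u z = norm (f z) powr p" for z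
  define \<tau> where "\<tau> z = bg_rho \<gamma> z powr conj_exp p" for z :: "(real^'m) \<times> (real^'k)"
  define W where "W z = bg_weight \<gamma> p z * norm (bg_grad \<gamma> f z) powr p" for z
  define E where "E z = p * norm (f z) powr (p - 2) * (f z \<bullet> Df z (fst z, (1 + \<gamma>) *\<^sub>R snd z))" for z
  define A where "A = (\<integral>z. u z \<partial>lborel)"
  define B where "B = (\<integral>z. \<tau> z * u z \<partial>lborel)"
  define Q where "Q = hom_dim CARD('m) CARD('k) \<gamma>"
  define \<alpha> where "\<alpha> = bg_alpha p \<gamma> f"
  define \<kappa> where "\<kappa> = \<alpha> * conj_exp p"

  have u_cont: "continuous_on UNIV u"
    unfolding u_def using p by (intro continuous_on_powr' continuous_on_norm f_cont continuous_intros) auto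
  have \<tau>_cont: "continuous_on UNIV \<tau>"
    unfolding \<tau>_def using p
    by (intro continuous_on_powr' continuous_on_bg_rho \<gamma> continuous_intros) (auto simp: conj_exp_def bg_rho_def)
  have iA: "integrable lborel u"
    using u_cont K(1) by (rule integrable_lborel_compact_support) (simp add: u_def f_off)
  have cB: "continuous_on UNIV (\<lambda>z. \<tau> z * u z)" by (intro continuous_intros \<tau>_cont u_cont)
  have iB: "integrable lborel (\<lambda>z. \<tau> z * u z)"
    using cB K(1) by (rule integrable_lborel_compact_support) (simp add: u_def f_off)

  have "continuous_on \<Omega> W"
  proof -
    have "bg_rho \<gamma> z \<noteq> 0" if "z \<in> \<Omega>" for z
      using bg_rho_pos[of z \<gamma>] that by (simp add: \<Omega>_def)
    then have "continuous_on \<Omega> (\<lambda>z. bg_weight \<gamma> p z)"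
      unfolding bg_weight_def
      by (intro continuous_intros continuous_on_powr continuous_on_bg_rho \<gamma>) (auto simp: \<Omega>_def)
    moreover have "continuous_on \<Omega> (\<lambda>z. bg_grad \<gamma> f z)"
      unfolding bg_grad_def
    proof (rule continuous_on_vec_lambda)
      fix i :: "'m + 'k"
      show "continuous_on \<Omega> (\<lambda>z. case i of Inl a \<Rightarrow> frechet_derivative f (at z) (axis a 1, 0)
        | Inr b \<Rightarrow> of_real (norm (fst z) powr \<gamma>) * frechet_derivative f (at z) (0, axis b 1))"
        unfolding Df_def[symmetric]
        by (cases i) (auto intro!: continuous_intros Df_cont continuous_on_powr, simp add: \<Omega>_def)
    qed
    ultimately show ?thesis
      unfolding W_def using p
      by (intro continuous_on_mult continuous_on_powr' continuous_on_norm continuous_on_const) auto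
  qed
  moreover have bg_off: "bg_grad \<gamma> f z = 0" if "z \<notin> K" for z
    using Df_off[OF that] by (auto simp: bg_grad_def vec_eq_iff Df_def split: sum.split)
  ultimately have "continuous_on UNIV W"
    using open_\<Omega> K compact_imp_closed[OF K(1)]
    by (intro continuous_on_extend_by_zero[of \<Omega> K]) (auto simp: W_def)
  then have iW: "integrable lborel W"
    using K(1) by (rule integrable_lborel_compact_support) (simp add: W_def bg_off)

  obtain a where a: "f a \<noteq> 0" using assms(4) by blast
  then have a\<Omega>: "fst a \<noteq> 0" using f_off[of a] K(2) unfolding \<Omega>_def by blast
  have A: "0 < A"
    unfolding A_def using u_cont iA a by (intro integral_pos_of_continuous[of u a]) (auto simp: u_def)
  have B: "0 < B"
    unfolding B_def using cB iB a bg_rho_pos[OF a\<Omega>, of \<gamma>]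
    by (intro integral_pos_of_continuous[of _ a]) (auto simp: u_def \<tau>_def)
  have Q: "0 < Q"
    using \<gamma> by (auto simp: Q_def hom_dim_def intro!: add_pos_nonneg)
  have \<alpha>_eq: "\<alpha> = Q / p * ((p - 1) / p) * (A / B)"
    by (simp add: \<alpha>_def bg_alpha_def Q_def A_def B_def u_def \<tau>_def)
  have \<alpha>: "0 < \<alpha>" using A B Q p by (simp add: \<alpha>_eq)
  define X where "X = Q / p * A"
  have X: "0 < X" using A Q p by (simp add: X_def)
  have \<kappa>_X: "\<kappa> = X / B"
    using p by (simp add: \<kappa>_def \<alpha>_eq conj_exp_def X_def)

  have du: "(u has_derivative (\<lambda>h. p * norm (f z) powr (p - 2) * (f z \<bullet> Df z h))) (at z)" for z
    unfolding u_def by (rule has_derivative_compose[OF df has_derivative_norm_powr[OF p]])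
  obtain R where R: "\<And>z. z \<in> K \<Longrightarrow> norm z \<le> R"
    using compact_imp_bounded[OF K(1)] by (auto simp: bounded_iff)
  obtain M where M: "\<And>z. z \<in> K \<Longrightarrow> norm (f z) \<le> M"
    using compact_imp_bounded[OF compact_continuous_image[OF continuous_on_subset[OF f_cont] K(1)]]
    by (force simp: bounded_iff)
  have "continuous_on K (\<lambda>z. \<Sum>b\<in>Basis. norm (Df z b))"
    using Df_cont K(2) by (intro continuous_intros) (auto intro: continuous_on_subset)
  then have "bounded ((\<lambda>z. \<Sum>b\<in>Basis. norm (Df z b)) ` K)"
    using K(1) by (intro compact_imp_bounded compact_continuous_image)
  then obtain M' where M'_abs: "\<And>z. z \<in> K \<Longrightarrow> norm (\<Sum>b\<in>Basis. norm (Df z b)) \<le> M'"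
    unfolding bounded_iff by blast
  have M': "(\<Sum>b\<in>Basis. norm (Df z b)) \<le> M'" if "z \<in> K" for z
    using M'_abs[OF that] by simp
  \<comment> \<open>For \<open>p < 2\<close> the factor \<open>|f|\<^sup>p\<^sup>-\<^sup>2\<close> blows up towards zeros of \<open>f\<close>; the factor \<open>f\<close> in the inner product
     compensates, since \<open>|f|\<^sup>p\<^sup>-\<^sup>2 |f| = |f|\<^sup>p\<^sup>-\<^sup>1\<close> and \<open>p > 1\<close>.\<close>
  have du_bound: "\<bar>p * norm (f z) powr (p - 2) * (f z \<bullet> Df z b)\<bar> \<le> p * (\<bar>M\<bar> powr (p - 1) * \<bar>M'\<bar>)"
    if b: "b \<in> Basis" for z b
  proof (cases "z \<in> K")
    case True
    have "norm (Df z b) \<le> (\<Sum>b\<in>Basis. norm (Df z b))"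
      using b by (intro member_le_sum) auto
    then have 1: "norm (Df z b) \<le> \<bar>M'\<bar>" using M'[OF True] by linarith
    have 2: "norm (f z) powr (p - 1) \<le> \<bar>M\<bar> powr (p - 1)"
      using M[OF True] p by (intro powr_mono2) auto
    have "norm (f z) powr (p - 2) * \<bar>f z \<bullet> Df z b\<bar> \<le> norm (f z) powr (p - 2) * (norm (f z) * norm (Df z b))"
      by (intro mult_left_mono Cauchy_Schwarz_ineq2) auto
    also have "\<dots> = norm (f z) powr (p - 1) * norm (Df z b)"
      using powr_add[of "norm (f z)" "p - 2" 1] by (simp add: mult_ac)
    also have "\<dots> \<le> \<bar>M\<bar> powr (p - 1) * \<bar>M'\<bar>"
      using 1 2 by (intro mult_mono) auto
    finally show ?thesis using p by (simp add: abs_mult mult.assoc)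
  qed (use p f_off in simp)
  have u_off: "u z = 0" if "R < norm z" for z
    using that R[of z] f_off[of z] by (force simp: u_def)
  have iE: "integrable lborel E" and int_E: "(\<integral>z. E z \<partial>lborel) = - Q * A"
    unfolding E_def Q_def A_def
    by (rule integral_anisotropic_euler_field[OF du du_bound u_off], assumption+)+

  have pointwise: "bg_weight \<gamma> p z * Cp p (bg_grad \<gamma> f z)
        (bg_gauss \<alpha> p \<gamma> z *\<^sub>R bg_grad \<gamma> (\<lambda>w. f w / of_real (bg_gauss \<alpha> p \<gamma> w)) z)
      = W z + (p - 1) * \<kappa> powr p * (\<tau> z * u z) + \<kappa> powr (p - 1) * E z" for z
  proof (cases "fst z = 0")
    case True
    then have "f z = 0" using f_off[of z] K(2) unfolding \<Omega>_def by blast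
    moreover have "bg_weight \<gamma> p z = 0" using True by (simp add: bg_weight_def)
    ultimately show ?thesis by (simp add: W_def u_def E_def)
  next
    case False
    have "f differentiable (at z)" using df by (rule differentiableI)
    from weighted_Cp_pointwise[OF p \<gamma> \<alpha> False this] show ?thesis
      unfolding W_def u_def \<tau>_def E_def \<kappa>_def Df_def .
  qed
  have "(\<integral>z. bg_weight \<gamma> p z * Cp p (bg_grad \<gamma> f z)
        (bg_gauss \<alpha> p \<gamma> z *\<^sub>R bg_grad \<gamma> (\<lambda>w. f w / of_real (bg_gauss \<alpha> p \<gamma> w)) z) \<partial>lborel)
      = (\<integral>z. W z \<partial>lborel) + (p - 1) * \<kappa> powr p * B - \<kappa> powr (p - 1) * (Q * A)"
    unfolding pointwise using iW iB iE by (simp add: int_E B_def)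
  \<comment> \<open>The constant \<open>\<alpha>\<close> is chosen so that \<open>\<kappa> B = X\<close>. The order-zero term and the Euler term then
     contribute \<open>p - 1\<close> and \<open>- p\<close> copies of \<open>X\<^sup>p\<close>, and one negative copy survives.\<close>
  moreover have "B powr (p - 1) * (\<kappa> powr p * B) = X powr p"
  proof -
    have "B powr (p - 1) * (\<kappa> powr p * B) = \<kappa> powr p * B powr p"
      using B powr_add[of B "p - 1" 1] by simp
    also have "\<dots> = X powr p" using X B by (simp add: \<kappa>_X powr_divide)
    finally show ?thesis .
  qed
  moreover have "B powr (p - 1) * (\<kappa> powr (p - 1) * (Q * A)) = p * X powr p"
  proof -
    have "B powr (p - 1) * (\<kappa> powr (p - 1) * (Q * A)) = p * (X powr (p - 1) * X)"
      using X B p by (simp add: \<kappa>_X powr_divide) (simp add: X_def)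
    also have "X powr (p - 1) * X = X powr p"
      using X powr_add[of X "p - 1" 1] by simp
    finally show ?thesis .
  qed
  moreover have "X powr p = (Q / p) powr p * A powr p"
    unfolding X_def by (rule powr_mult)
  ultimately have "(\<integral>z. W z \<partial>lborel) * B powr (p - 1) = (Q / p) powr p * A powr p
      + B powr (p - 1) * (\<integral>z. bg_weight \<gamma> p z * Cp p (bg_grad \<gamma> f z)
        (bg_gauss \<alpha> p \<gamma> z *\<^sub>R bg_grad \<gamma> (\<lambda>w. f w / of_real (bg_gauss \<alpha> p \<gamma> w)) z) \<partial>lborel)"
    by (simp add: distrib_left right_diff_distrib left_diff_distrib mult_ac)
  then show ?thesis
    unfolding W_def A_def B_def Q_def \<alpha>_def u_def \<tau>_def .
qed

end
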